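(* Let $\mathcal{O}$ be an $R$-order ($R\in\{\mathbb{Z},\mathbb{Z}[\varphi]\}$) in a real composition algebra $A$ of real dimension $d$, let $U=\mathcal{S}_1(\mathcal{O})$, and let $h_A(a,b)=(2a\bar b,\,N(a)-N(b))\in A\oplus\mathbb{R}$ be the algebraic Hopf map. For $(a,b)$ in the balanced shell $\mathcal{D}(\mathcal{O})$, the second coordinate of $h_A(a,b)$ vanishes: $$h_A\bigl(\mathcal{D}(\mathcal{O})\bigr)\subseteq S^{d-1}\times\{0\}\subset S^d .$$ Identifying $S^{d-1}\times\{0\}\subset A\oplus\mathbb{R}$ with the unit sphere of $A$, the restriction $h_A|_{\mathcal{D}(\mathcal{O})}$ coincides with the principal fibration $\pi(u,v)=u\bar v$ of $U\times U\to U$, up to the normalisation factor $\tfrac12$ from the scaling of $\mathcal{D}(\mathcal{O})$.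
   Context: $\varphi=(1+\sqrt5)/2$. $A$ is one of $\mathbb{R},\mathbb{C},\mathbb{H},\mathbb{O}$ with its standard positive definite multiplicative norm $N$, polar form $B(x,y)=N(x+y)-N(x)-N(y)=x\bar y+y\bar x$ and conjugation $\bar x=B(x,1)\cdot1-x$. An $R$-order in $A$ is a finitely generated $R$-submodule $\mathcal{O}\subset A$ with $1\in\mathcal{O}$, $\overline{\mathcal{O}}=\mathcal{O}$, $\mathcal{O}\cdot\mathcal{O}\subseteq\mathcal{O}$, $N(\mathcal{O})\subseteq R$, and $B$ restricting to an $R$-bilinear map $\mathcal{O}\times\mathcal{O}\to R$. $\mathcal{S}_1(\mathcal{O})=\{x\in\mathcal{O}:N(x)=1\}$. The balanced shell is $\mathcal{D}(\mathcal{O})=\tfrac1{\sqrt2}(\mathcal{S}_1(\mathcal{O})\times\mathcal{S}_1(\mathcal{O}))\subset S^{2d-1}\subset A^2$, so its points are $(u/\sqrt2,v/\sqrt2)$ with $u,v\in U$. The algebraic Hopf map $h_A$ is a map from $S^{2d-1}\subset A^2$ to $S^d\subset A\oplus\mathbb{R}$. The principal fibration is the map $\pi:U\times U\to U$, $\pi(u,v)=u\bar v=uv^{-1}$. $S^{d-1}=\{x\in A:N(x)=1\}$ and $S^d=\{(x,t)\in A\oplus\mathbb{R}:N(x)+t^2=1\}$. *)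

theory Defs
  imports "HOL-Analysis.Analysis"
begin

text \<open>
  A composition algebra on the whole of a real vector space: addition and real scaling
  come from the type, the (not necessarily associative) product, the unit and the norm
  form \<open>N\<close> (a quadratic form, not its square root) are components of the record.
\<close>

record 'a comp_alg =
  ca_mult :: "'a \<Rightarrow> 'a \<Rightarrow> 'a"
  ca_one :: 'a
  ca_N :: "'a \<Rightarrow> real"

definition ca_B :: "'a::real_vector comp_alg \<Rightarrow> 'a \<Rightarrow> 'a \<Rightarrow> real" where
  "ca_B A x y = ca_N A (x + y) - ca_N A x - ca_N A y"

definition ca_conj :: "'a::real_vector comp_alg \<Rightarrow> 'a \<Rightarrow> 'a" where
  "ca_conj A x = ca_B A x (ca_one A) *\<^sub>R ca_one A - x"

definition ca_inverse :: "'a comp_alg \<Rightarrow> 'a \<Rightarrow> 'a" where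
  "ca_inverse A x = (THE y. ca_mult A x y = ca_one A \<and> ca_mult A y x = ca_one A)"

definition real_alg :: "real comp_alg" where
  "real_alg = \<lparr>ca_mult = (*), ca_one = 1, ca_N = (\<lambda>x. x\<^sup>2)\<rparr>"

definition complex_alg :: "complex comp_alg" where
  "complex_alg = \<lparr>ca_mult = (*), ca_one = 1, ca_N = (\<lambda>z. (cmod z)\<^sup>2)\<rparr>"

text \<open>Cayley--Dickson doubling; the pair \<open>(a, b)\<close> stands for \<open>a + b l\<close> with \<open>l l = - 1\<close>.\<close>

definition ca_double :: "'a::real_vector comp_alg \<Rightarrow> ('a \<times> 'a) comp_alg" where
  "ca_double A =
    \<lparr>ca_mult = (\<lambda>(a, b) (c, d).
        (ca_mult A a c - ca_mult A (ca_conj A d) b, ca_mult A d a + ca_mult A b (ca_conj A c))),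
     ca_one = (ca_one A, 0),
     ca_N = (\<lambda>(a, b). ca_N A a + ca_N A b)\<rparr>"

definition quaternion_alg :: "(complex \<times> complex) comp_alg" where
  "quaternion_alg = ca_double complex_alg"

definition octonion_alg :: "((complex \<times> complex) \<times> (complex \<times> complex)) comp_alg" where
  "octonion_alg = ca_double quaternion_alg"

definition ca_iso :: "'a::real_vector comp_alg \<Rightarrow> 'b::real_vector comp_alg \<Rightarrow> bool" where
  "ca_iso A A' \<longleftrightarrow> (\<exists>f. linear f \<and> bij f \<and> f (ca_one A) = ca_one A' \<and>
     (\<forall>x y. f (ca_mult A x y) = ca_mult A' (f x) (f y)) \<and>
     (\<forall>x. ca_N A' (f x) = ca_N A x))"

text \<open>\<open>A\<close> is one of the real, complex, quaternion or octonion algebras with its standard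
  norm. These live on different types, so ``is'' means ``is isomorphic to''.\<close>

definition real_composition_algebra :: "'a::real_vector comp_alg \<Rightarrow> bool" where
  "real_composition_algebra A \<longleftrightarrow>
     ca_iso A real_alg \<or> ca_iso A complex_alg \<or> ca_iso A quaternion_alg \<or> ca_iso A octonion_alg"

definition golden_ratio :: real where
  "golden_ratio = (1 + sqrt 5) / 2"

text \<open>Since \<open>\<phi>\<^sup>2 = \<phi> + 1\<close>, the ring generated by \<open>\<phi>\<close> is spanned over the integers by \<open>1\<close> and \<open>\<phi>\<close>.\<close>

definition golden_integers :: "real set" where
  "golden_integers = {of_int m + of_int n * golden_ratio | m n. True}"

definition fg_submodule :: "real set \<Rightarrow> 'a::real_vector set \<Rightarrow> bool" where
  "fg_submodule R M \<longleftrightarrow>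
     0 \<in> M \<and> (\<forall>x\<in>M. \<forall>y\<in>M. x + y \<in> M) \<and> (\<forall>r\<in>R. \<forall>x\<in>M. r *\<^sub>R x \<in> M) \<and>
     (\<exists>F. finite F \<and> F \<subseteq> M \<and>
        (\<forall>x\<in>M. \<exists>c. (\<forall>g\<in>F. c g \<in> R) \<and> x = (\<Sum>g\<in>F. c g *\<^sub>R g)))"

definition bilinear_map_on :: "real set \<Rightarrow> 'a::real_vector set \<Rightarrow> ('a \<Rightarrow> 'a \<Rightarrow> real) \<Rightarrow> bool" where
  "bilinear_map_on R M b \<longleftrightarrow>
     (\<forall>x\<in>M. \<forall>y\<in>M. b x y \<in> R) \<and>
     (\<forall>x\<in>M. \<forall>y\<in>M. \<forall>z\<in>M. b (x + y) z = b x z + b y z \<and> b z (x + y) = b z x + b z y) \<and>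
     (\<forall>r\<in>R. \<forall>x\<in>M. \<forall>y\<in>M. b (r *\<^sub>R x) y = r * b x y \<and> b x (r *\<^sub>R y) = r * b x y)"

definition R_order :: "'a::real_vector comp_alg \<Rightarrow> real set \<Rightarrow> 'a set \<Rightarrow> bool" where
  "R_order A R \<O> \<longleftrightarrow>
     fg_submodule R \<O> \<and> ca_one A \<in> \<O> \<and> ca_conj A ` \<O> = \<O> \<and>
     (\<forall>x\<in>\<O>. \<forall>y\<in>\<O>. ca_mult A x y \<in> \<O>) \<and>
     ca_N A ` \<O> \<subseteq> R \<and> bilinear_map_on R \<O> (ca_B A)"

definition unit_shell :: "'a comp_alg \<Rightarrow> 'a set \<Rightarrow> 'a set" where
  "unit_shell A \<O> = {x \<in> \<O>. ca_N A x = 1}"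

definition shell_scale :: "'a::real_vector \<times> 'a \<Rightarrow> 'a \<times> 'a" where
  "shell_scale = (\<lambda>(u, v). ((1 / sqrt 2) *\<^sub>R u, (1 / sqrt 2) *\<^sub>R v))"

definition balanced_shell :: "'a::real_vector comp_alg \<Rightarrow> 'a set \<Rightarrow> ('a \<times> 'a) set" where
  "balanced_shell A \<O> = shell_scale ` (unit_shell A \<O> \<times> unit_shell A \<O>)"

definition sphere_A :: "'a comp_alg \<Rightarrow> 'a set" where
  "sphere_A A = {x. ca_N A x = 1}"

definition sphere_AR :: "'a comp_alg \<Rightarrow> ('a \<times> real) set" where
  "sphere_AR A = {(x, t). ca_N A x + t\<^sup>2 = 1}"

definition hopf :: "'a::real_vector comp_alg \<Rightarrow> 'a \<times> 'a \<Rightarrow> 'a \<times> real" where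
  "hopf A = (\<lambda>(a, b). (2 *\<^sub>R ca_mult A a (ca_conj A b), ca_N A a - ca_N A b))"

definition principal_fibration :: "'a::real_vector comp_alg \<Rightarrow> 'a \<times> 'a \<Rightarrow> 'a" where
  "principal_fibration A = (\<lambda>(u, v). ca_mult A u (ca_conj A v))"

lemma ca_conj_real_alg: "ca_conj real_alg x = x"
  by (simp add: ca_conj_def ca_B_def real_alg_def power2_eq_square algebra_simps)

lemma ca_conj_complex_alg: "ca_conj complex_alg z = cnj z"
  unfolding ca_conj_def ca_B_def complex_alg_def comp_alg.simps cmod_power2
  by (simp add: complex_eq_iff power2_eq_square algebra_simps)

lemma ca_conj_double: "ca_N A 0 = 0 \<Longrightarrow> ca_conj (ca_double A) (a, b) = (ca_conj A a, - b)"
  by (simp add: ca_conj_def ca_B_def ca_double_def)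

end

theory Submission
  imports Defs
begin

text \<open>
  The computation itself is short. Conjugation is real linear, so
  \<open>a = u / \<surd>2\<close> and \<open>b = v / \<surd>2\<close> give \<open>a (conj b) = (u (conj v)) / 2\<close>;
  the factor \<open>2\<close> in the Hopf map cancels the \<open>1 / 2\<close>, and the second coordinate is
  \<open>(N u - N v) / 2 = 0\<close>. The value \<open>u (conj v)\<close> is again a unit of the order because an order
  is closed under products and conjugation and \<open>N\<close> is multiplicative and invariant under
  conjugation.

  What needs an argument is that \<open>N\<close> is multiplicative on all four algebras, and that
  \<open>conj v\<close> is the only two-sided inverse of a unit \<open>v\<close>. Over the octonions there is no
  associativity to give uniqueness. Both points are reduced to the axioms of a unital algebra
  with a multiplicative positive definite quadratic form. Polarizing \<open>N (x y) = N x N y\<close> shows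
  that multiplication by \<open>conj x\<close> is the \<open>B\<close>-adjoint of multiplication by \<open>x\<close>; as \<open>B\<close> is
  nondegenerate, this gives \<open>conj x (x y) = N x y\<close>, the fragment of associativity that
  uniqueness of inverses requires (\<open>conj_mult_cancel_left\<close>). The same adjunction shows that the
  Cayley--Dickson double of an associative algebra of this kind satisfies the axioms again
  (\<open>N_double_mult\<close>). Hence they pass from the complex numbers to the quaternions, and, as the
  quaternions are associative, on to the octonions. All axioms are transported by isomorphisms.
\<close>

section \<open>Composition algebras with a positive definite norm\<close>

locale euclidean_composition_algebra =
  fixes A :: "'a::real_vector comp_alg"
  assumes mult_bilinear: "bilinear (ca_mult A)"
    and mult_one_left: "ca_mult A (ca_one A) x = x"
    and mult_one_right: "ca_mult A x (ca_one A) = x"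
    and N_one: "ca_N A (ca_one A) = 1"
    and N_scaleR: "ca_N A (r *\<^sub>R x) = r\<^sup>2 * ca_N A x"
    and B_bilinear: "bilinear (ca_B A)"
    and N_pos: "x \<noteq> 0 \<Longrightarrow> 0 < ca_N A x"
    and N_mult: "ca_N A (ca_mult A x y) = ca_N A x * ca_N A y"
begin

abbreviation mult (infixl "\<odot>" 70) where "x \<odot> y \<equiv> ca_mult A x y"
abbreviation one ("\<e>") where "\<e> \<equiv> ca_one A"
abbreviation N where "N \<equiv> ca_N A"
abbreviation B where "B \<equiv> ca_B A"
abbreviation conj where "conj \<equiv> ca_conj A"

lemmas mult_simps =
  bilinear_ladd[OF mult_bilinear] bilinear_radd[OF mult_bilinear]
  bilinear_lsub[OF mult_bilinear] bilinear_rsub[OF mult_bilinear]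
  bilinear_lmul[OF mult_bilinear] bilinear_rmul[OF mult_bilinear]

lemmas B_simps =
  bilinear_ladd[OF B_bilinear] bilinear_radd[OF B_bilinear]
  bilinear_lsub[OF B_bilinear] bilinear_rsub[OF B_bilinear]
  bilinear_lmul[OF B_bilinear] bilinear_rmul[OF B_bilinear]
  bilinear_lneg[OF B_bilinear] bilinear_rneg[OF B_bilinear]

lemma N_zero: "N 0 = 0"
  using N_scaleR[of 0 0] by simp

lemma N_add: "N (x + y) = N x + N y + B x y"
  by (simp add: ca_B_def)

lemma N_minus: "N (- x) = N x"
  using N_scaleR[of "- 1" x] by simp

lemma N_diff: "N (x - y) = N x + N y - B x y"
  using N_add[of x "- y"] by (simp add: N_minus B_simps)

lemma B_commute: "B x y = B y x"
  by (simp add: ca_B_def add.commute)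

lemma B_self: "B x x = 2 * N x"
  using N_scaleR[of 2 x] by (simp add: ca_B_def scaleR_2)

text \<open>Positive definiteness enters here: equations in the algebra can be tested by pairing
  with an arbitrary element.\<close>

lemma B_nondegenerate:
  assumes "\<And>z. B x z = B y z"
  shows "x = y"
proof (rule ccontr)
  assume "x \<noteq> y"
  then have "0 < N (x - y)" by (simp add: N_pos)
  moreover have "2 * N (x - y) = 0"
    using assms[of "x - y"] by (simp add: B_self[symmetric] B_simps)
  ultimately show False by simp
qed

text \<open>Compare the parts bilinear in the varied factor of \<open>N (x (y + z)) = N x N (y + z)\<close>, and
  likewise on the other side.\<close>

lemma N_mult_polarized:
  "B (x \<odot> y) (x \<odot> z) = N x * B y z"
  "B (x \<odot> z) (y \<odot> z) = B x y * N z"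
  unfolding ca_B_def mult_simps[symmetric] N_mult by (simp_all add: algebra_simps)

text \<open>A second polarization, now in the factor that was kept fixed. Setting one of the four
  arguments to \<open>\<e>\<close> yields the two adjunctions that follow.\<close>

lemma N_mult_polarized_twice:
  "B (x \<odot> y) (z \<odot> w) + B (z \<odot> y) (x \<odot> w) = B x z * B y w"
proof -
  have "B ((x + z) \<odot> y) ((x + z) \<odot> w) = N (x + z) * B y w"
    by (rule N_mult_polarized)
  then show ?thesis
    by (simp add: mult_simps B_simps N_mult_polarized N_add algebra_simps)
qed

lemma mult_adjoint_left: "B (x \<odot> y) z = B y (conj x \<odot> z)"
  using N_mult_polarized_twice[of x y \<e> z]
  by (simp add: ca_conj_def mult_simps B_simps mult_one_left)

lemma mult_adjoint_right: "B (x \<odot> y) z = B x (z \<odot> conj y)"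
  using N_mult_polarized_twice[of x y z \<e>]
  by (simp add: ca_conj_def mult_simps B_simps mult_one_right B_commute[of "z \<odot> y"] mult.commute)

lemma conj_linear: "linear conj"
  by (rule linearI) (simp_all add: ca_conj_def B_simps algebra_simps)

lemmas conj_scaleR = linear_cmul[OF conj_linear]

lemma N_conj: "N (conj x) = N x"
  by (simp add: ca_conj_def N_diff N_scaleR N_one B_simps B_commute[of \<e>] power2_eq_square)

lemma conj_one: "conj \<e> = \<e>"
  by (simp add: ca_conj_def B_self N_one scaleR_2)

text \<open>The products cannot be reassociated directly; moving \<open>conj x\<close> across \<open>B\<close> turns the claim
  into the polarized multiplicativity \<open>B (x y) (x z) = N x B y z\<close>.\<close>

lemma conj_mult_cancel_left: "conj x \<odot> (x \<odot> y) = N x *\<^sub>R y"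
proof (rule B_nondegenerate)
  fix z
  have "B (conj x \<odot> (x \<odot> y)) z = B (x \<odot> z) (x \<odot> y)"
    using mult_adjoint_left[of x z "x \<odot> y"] by (simp add: B_commute)
  also have "\<dots> = B (N x *\<^sub>R y) z"
    by (simp add: N_mult_polarized B_simps B_commute)
  finally show "B (conj x \<odot> (x \<odot> y)) z = B (N x *\<^sub>R y) z" .
qed

lemma mult_conj_cancel_right: "(y \<odot> x) \<odot> conj x = N x *\<^sub>R y"
proof (rule B_nondegenerate)
  fix z
  have "B ((y \<odot> x) \<odot> conj x) z = B (z \<odot> x) (y \<odot> x)"
    using mult_adjoint_right[of z x "y \<odot> x"] by (simp add: B_commute)
  also have "\<dots> = B (N x *\<^sub>R y) z"
    by (simp add: N_mult_polarized B_simps B_commute)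
  finally show "B ((y \<odot> x) \<odot> conj x) z = B (N x *\<^sub>R y) z" .
qed

lemma conj_mult_self: "conj x \<odot> x = N x *\<^sub>R \<e>"
  using conj_mult_cancel_left[of x \<e>] by (simp add: mult_one_right)

lemma mult_conj_self: "x \<odot> conj x = N x *\<^sub>R \<e>"
  using mult_conj_cancel_right[of \<e> x] by (simp add: mult_one_left)

lemma inverse_unit_eq_conj:
  assumes "N x = 1"
  shows "ca_inverse A x = conj x"
  unfolding ca_inverse_def
proof (rule the_equality)
  show "x \<odot> conj x = \<e> \<and> conj x \<odot> x = \<e>"
    using assms by (simp add: mult_conj_self conj_mult_self)
next
  fix y
  assume "x \<odot> y = \<e> \<and> y \<odot> x = \<e>"
  then show "y = conj x"
    using conj_mult_cancel_left[of x y] assms by (simp add: mult_one_right)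
qed

section \<open>The Hopf map and the fibration on unit shells\<close>

lemma hopf_shell_scale:
  assumes "N u = N v"
  shows "hopf A (shell_scale (u, v)) = (principal_fibration A (u, v), 0)"
  using assms
  by (simp add: hopf_def shell_scale_def principal_fibration_def conj_scaleR mult_simps N_scaleR)

text \<open>The inclusion is proper because of the pole \<open>(0, 1)\<close>.\<close>

lemma sphere_A_equator: "sphere_A A \<times> {0} \<subset> sphere_AR A"
proof
  show "sphere_A A \<times> {0} \<subseteq> sphere_AR A"
    by (auto simp: sphere_A_def sphere_AR_def)
  have "(0, 1) \<in> sphere_AR A"
    by (simp add: sphere_AR_def N_zero)
  then show "sphere_A A \<times> {0} \<noteq> sphere_AR A"
    by force
qed

lemma principal_fibration_unit_shell:
  assumes "R_order A R \<O>"
  shows "principal_fibration A \<in> unit_shell A \<O> \<times> unit_shell A \<O> \<rightarrow> unit_shell A \<O>"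
proof (rule funcsetI, clarify)
  fix u v
  assume u: "u \<in> unit_shell A \<O>" and v: "v \<in> unit_shell A \<O>"
  from assms v have "conj v \<in> \<O>"
    by (auto simp: R_order_def unit_shell_def)
  with assms u v show "principal_fibration A (u, v) \<in> unit_shell A \<O>"
    by (simp add: R_order_def unit_shell_def principal_fibration_def N_mult N_conj)
qed

section \<open>Cayley--Dickson doubling\<close>

lemma ca_B_double: "ca_B (ca_double A) (a, b) (c, d) = B a c + B b d"
  by (simp add: ca_B_def ca_double_def)

text \<open>Expanding \<open>N\<close> on both components of \<open>(a, b) (c, d)\<close> gives the four terms of the product of
  norms and the cross terms \<open>B (d a) (b (conj c)) - B (a c) ((conj d) b)\<close>. Moving \<open>conj c\<close> and
  \<open>conj d\<close> across \<open>B\<close>, these become \<open>B ((d a) c) b - B (d (a c)) b\<close>, so they cancel by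
  associativity.\<close>

lemma N_double_mult:
  assumes assoc: "\<And>x y z. (x \<odot> y) \<odot> z = x \<odot> (y \<odot> z)"
  shows "ca_N (ca_double A) (ca_mult (ca_double A) p q) =
    ca_N (ca_double A) p * ca_N (ca_double A) q"
proof -
  obtain a b c d where pq: "p = (a, b)" "q = (c, d)" by (metis surj_pair)
  have "B (d \<odot> a) (b \<odot> conj c) = B ((d \<odot> a) \<odot> c) b"
    by (simp add: mult_adjoint_right)
  also have "\<dots> = B (a \<odot> c) (conj d \<odot> b)"
    by (simp add: assoc mult_adjoint_left)
  finally have "B (d \<odot> a) (b \<odot> conj c) = B (a \<odot> c) (conj d \<odot> b)" .
  then show ?thesis
    by (simp add: pq ca_double_def N_add N_diff N_mult N_conj algebra_simps)
qed

lemma euclidean_composition_algebra_double: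
  assumes assoc: "\<And>x y z. (x \<odot> y) \<odot> z = x \<odot> (y \<odot> z)"
  shows "euclidean_composition_algebra (ca_double A)"
proof
  note conj_simps = linear_add[OF conj_linear] conj_scaleR
  show "bilinear (ca_mult (ca_double A))"
    unfolding bilinear_def
    by (intro conjI allI linearI)
      (auto simp: ca_double_def mult_simps conj_simps algebra_simps)
  show "bilinear (ca_B (ca_double A))"
    unfolding bilinear_def
    by (intro conjI allI linearI) (auto simp: ca_B_double B_simps algebra_simps)
  have "conj 0 = 0" by (rule linear_0[OF conj_linear])
  then show "ca_mult (ca_double A) (ca_one (ca_double A)) x = x"
    "ca_mult (ca_double A) x (ca_one (ca_double A)) = x" for x
    using conj_one by (cases x, simp add: ca_double_def mult_one_left mult_one_right
      bilinear_lzero[OF mult_bilinear] bilinear_rzero[OF mult_bilinear])+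
  show "ca_N (ca_double A) (ca_one (ca_double A)) = 1"
    by (simp add: ca_double_def N_one N_zero)
  show "ca_N (ca_double A) (r *\<^sub>R x) = r\<^sup>2 * ca_N (ca_double A) x" for r x
    by (cases x) (simp add: ca_double_def N_scaleR algebra_simps)
  show "0 < ca_N (ca_double A) x" if "x \<noteq> 0" for x
  proof -
    obtain a b where x: "x = (a, b)" by (cases x)
    have "0 \<le> N a" "0 \<le> N b" using N_pos N_zero by (metis less_eq_real_def order_refl)+
    then show ?thesis
      using that N_pos[of a] N_pos[of b]
      by (auto simp: x ca_double_def zero_prod_def N_zero intro: add_pos_nonneg add_nonneg_pos)
  qed
  show "ca_N (ca_double A) (ca_mult (ca_double A) x y) =
    ca_N (ca_double A) x * ca_N (ca_double A) y" for x y
    using assoc by (rule N_double_mult)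
qed

end

section \<open>The four standard algebras\<close>

lemma euclidean_composition_algebra_real: "euclidean_composition_algebra real_alg"
proof
  have B: "ca_B real_alg = (\<lambda>x y. 2 * (x * y))"
    by (simp add: fun_eq_iff ca_B_def real_alg_def power2_eq_square algebra_simps)
  show "bilinear (ca_B real_alg)"
    unfolding B bilinear_def by (intro conjI allI linearI) (simp_all add: algebra_simps)
  show "bilinear (ca_mult real_alg)"
    unfolding bilinear_def
    by (intro conjI allI linearI) (simp_all add: real_alg_def algebra_simps)
qed (simp_all add: real_alg_def power_mult_distrib)

lemma euclidean_composition_algebra_complex: "euclidean_composition_algebra complex_alg"
proof
  have B: "ca_B complex_alg = (\<lambda>x y. 2 * (x \<bullet> y))"
    by (simp add: fun_eq_iff ca_B_def complex_alg_def power2_norm_eq_inner inner_add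
        inner_commute)
  show "bilinear (ca_B complex_alg)"
    unfolding B bilinear_def
    by (intro conjI allI linearI) (simp_all add: inner_simps algebra_simps)
  show "bilinear (ca_mult complex_alg)"
    unfolding bilinear_def
    by (intro conjI allI linearI) (simp_all add: complex_alg_def algebra_simps)
qed (simp_all add: complex_alg_def norm_mult power_mult_distrib)

lemma quaternion_mult_assoc:
  "ca_mult quaternion_alg (ca_mult quaternion_alg x y) z =
    ca_mult quaternion_alg x (ca_mult quaternion_alg y z)"
proof -
  have "ca_mult complex_alg = (*)" by (simp add: complex_alg_def)
  then show ?thesis
    by (cases x; cases y; cases z)
      (simp add: quaternion_alg_def ca_double_def ca_conj_complex_alg algebra_simps)
qed

lemma euclidean_composition_algebra_quaternion: "euclidean_composition_algebra quaternion_alg"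
  unfolding quaternion_alg_def
  by (rule euclidean_composition_algebra.euclidean_composition_algebra_double
      [OF euclidean_composition_algebra_complex]) (simp add: complex_alg_def)

lemma euclidean_composition_algebra_octonion: "euclidean_composition_algebra octonion_alg"
  unfolding octonion_alg_def
  by (rule euclidean_composition_algebra.euclidean_composition_algebra_double
      [OF euclidean_composition_algebra_quaternion quaternion_mult_assoc])

text \<open>Each axiom is an identity or a statement about \<open>N\<close>, so it can be read off after applying
  the injective map \<open>f\<close>.\<close>

lemma euclidean_composition_algebra_iso:
  assumes "ca_iso A A'" and "euclidean_composition_algebra A'"
  shows "euclidean_composition_algebra A"
proof -
  interpret A': euclidean_composition_algebra A' by fact
  obtain f where f: "linear f" and bij: "bij f" and one: "f (ca_one A) = ca_one A'"
    and mult: "\<And>x y. f (ca_mult A x y) = ca_mult A' (f x) (f y)"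
    and N: "\<And>x. ca_N A x = ca_N A' (f x)"
    using assms(1) unfolding ca_iso_def by metis
  have inj: "inj f"
    using bij by (rule bij_is_inj)
  note f_simps = linear_add[OF f] linear_cmul[OF f]
  have B: "ca_B A x y = ca_B A' (f x) (f y)" for x y
    by (simp add: ca_B_def N f_simps)
  show ?thesis
  proof
    show "bilinear (ca_mult A)"
      unfolding bilinear_def
      by (intro conjI allI linearI; rule injD[OF inj]) (simp_all add: mult f_simps A'.mult_simps)
    show "bilinear (ca_B A)"
      unfolding bilinear_def
      by (intro conjI allI linearI) (simp_all add: B f_simps A'.B_simps)
    show "ca_mult A (ca_one A) x = x" "ca_mult A x (ca_one A) = x" for x
      by (rule injD[OF inj], simp add: mult one A'.mult_one_left A'.mult_one_right)+
    show "0 < ca_N A x" if "x \<noteq> 0" for x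
      using that A'.N_pos[of "f x"] inj_eq[OF inj, of x 0] by (simp add: N linear_0[OF f])
  qed (simp_all add: N one mult f_simps A'.N_one A'.N_scaleR A'.N_mult)
qed

lemma euclidean_composition_algebra_if_real_composition_algebra:
  assumes "real_composition_algebra A"
  shows "euclidean_composition_algebra A"
  using assms unfolding real_composition_algebra_def
  by (auto intro: euclidean_composition_algebra_iso euclidean_composition_algebra_real
      euclidean_composition_algebra_complex euclidean_composition_algebra_quaternion
      euclidean_composition_algebra_octonion)

section \<open>The Hopf map restricts to the principal fibration\<close>

theorem proposition7p3:
  fixes A :: "'a::real_vector comp_alg"
    and R :: "real set"
    and \<O> U :: "'a set"
    and d :: nat
  assumes "real_composition_algebra A"
    and "d = dim (UNIV :: 'a set)"
    and "R = \<int> \<or> R = golden_integers"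
    and "R_order A R \<O>"
    and "U = unit_shell A \<O>"
  shows "(\<forall>(a, b) \<in> balanced_shell A \<O>. snd (hopf A (a, b)) = 0) \<and>
    hopf A ` balanced_shell A \<O> \<subseteq> sphere_A A \<times> {0} \<and>
    sphere_A A \<times> {0} \<subset> sphere_AR A \<and>
    principal_fibration A \<in> U \<times> U \<rightarrow> U \<and>
    (\<forall>u\<in>U. \<forall>v\<in>U. principal_fibration A (u, v) = ca_mult A u (ca_inverse A v)) \<and>
    (\<forall>u\<in>U. \<forall>v\<in>U. hopf A (shell_scale (u, v)) = (principal_fibration A (u, v), 0)) \<and>
    (\<forall>u\<in>U. \<forall>v\<in>U. \<forall>a b. (a, b) = shell_scale (u, v) \<longrightarrow>
       ca_mult A a (ca_conj A b) = (1 / 2) *\<^sub>R principal_fibration A (u, v))"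
proof -
  interpret euclidean_composition_algebra A
    using assms(1) by (rule euclidean_composition_algebra_if_real_composition_algebra)
  have N: "ca_N A u = 1" if "u \<in> U" for u
    using that assms(5) by (simp add: unit_shell_def)
  have hopf: "hopf A (shell_scale (u, v)) = (principal_fibration A (u, v), 0)"
    if "u \<in> U" "v \<in> U" for u v
    using that by (simp add: hopf_shell_scale N)
  have pi: "principal_fibration A \<in> U \<times> U \<rightarrow> U"
    using principal_fibration_unit_shell[OF assms(4)] assms(5) by simp
  have shell: "balanced_shell A \<O> = shell_scale ` (U \<times> U)"
    by (simp add: balanced_shell_def assms(5))
  have image: "hopf A ` balanced_shell A \<O> \<subseteq> sphere_A A \<times> {0}"
  proof
    fix p
    assume "p \<in> hopf A ` balanced_shell A \<O>"
    then obtain u v where uv: "u \<in> U" "v \<in> U" and p: "p = (principal_fibration A (u, v), 0)"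
      using hopf by (auto simp: shell)
    with pi have "principal_fibration A (u, v) \<in> U" by blast
    then show "p \<in> sphere_A A \<times> {0}"
      by (simp add: p sphere_A_def N)
  qed
  then have second: "\<forall>(a, b) \<in> balanced_shell A \<O>. snd (hopf A (a, b)) = 0"
    by fastforce
  have inv: "principal_fibration A (u, v) = ca_mult A u (ca_inverse A v)" if "v \<in> U" for u v
    using that by (simp add: principal_fibration_def inverse_unit_eq_conj N)
  have half: "ca_mult A a (ca_conj A b) = (1 / 2) *\<^sub>R principal_fibration A (u, v)"
    if "(a, b) = shell_scale (u, v)" for u v a b
    using that by (simp add: shell_scale_def principal_fibration_def conj_scaleR mult_simps)
  show ?thesis
    by (rule conjI[OF second] conjI[OF image] conjI[OF sphere_A_equator] conjI[OF pi])+
      (simp add: inv hopf half)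
qed

end
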